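(* A Boolean combination $\varphi$ of core formulae is valid if and only if $\vdash_{\mathsf{C}}\varphi$.
   Context: Syntax of $\mathrm{SL}(\ast,\mathrel{-\!\!\ast})$: fix a countably infinite set $\mathrm{PVAR}$ of program variables and a countably infinite set $\mathrm{LOC}$ of locations. Formulae: $\varphi ::= x = y \mid x \hookrightarrow y \mid \mathrm{emp} \mid \neg\varphi \mid \varphi\wedge\varphi \mid \varphi \ast \varphi \mid \varphi \mathrel{-\!\!\ast} \varphi$ ($x,y\in\mathrm{PVAR}$). Memory states $(s,h)$: $s:\mathrm{PVAR}\to\mathrm{LOC}$, $h$ a partial function $\mathrm{LOC}\to\mathrm{LOC}$ with finite domain. $(s,h)\models x=y$ iff $s(x)=s(y)$; $\models\mathrm{emp}$ iff $\mathrm{dom}(h)=\emptyset$; $\models x\hookrightarrow y$ iff $s(x)\in\mathrm{dom}(h)$ and $h(s(x))=s(y)$; Boolean connectives as usual; $\models\varphi_1\ast\varphi_2$ iff $h$ splits into two domain-disjoint heaps $h_1,h_2$ ($h=h_1+h_2$) with $(s,h_i)\models\varphi_i$; $\models\varphi_1\mathrel{-\!\!\ast}\varphi_2$ iff for every $h_1$ with domain disjoint from $\mathrm{dom}(h)$ and $(s,h_1)\models\varphi_1$, $(s,h+h_1)\models\varphi_2$. Valid = satisfied by all memory states. Abbreviations: $\bot:=\neg(x=x)$, $\top:=\neg\bot$, $\mathrm{alloc}(x):=(x\hookrightarrow x)\mathrel{-\!\!\ast}\bot$ (holds iff $s(x)\in\mathrm{dom}(h)$), $\mathrm{size}\ge0:=\top$,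 $\mathrm{size}\ge1:=\neg\mathrm{emp}$, $\mathrm{size}\ge\beta:=\neg\mathrm{emp}\ast\mathrm{size}\ge\beta-1$ for $\beta\ge2$ (holds iff $|\mathrm{dom}(h)|\ge\beta$). Core formulae are the formulae $x=y$, $\mathrm{alloc}(x)$, $x\hookrightarrow y$, $\mathrm{size}\ge\beta$ with $x,y\in\mathrm{PVAR}$, $\beta\in\mathbb{N}$. The proof system $\mathsf{C}$ (derivability is the least set of formulae containing all instances of the axiom schemata and closed under the rules) consists of all axiom schemata of classical propositional calculus, modus ponens, and: (1) $x=x$; (2) $\varphi\wedge x=y\Rightarrow\varphi'$, where $\varphi'$ is obtained from $\varphi$ by replacing every occurrence of $y$ with $x$; (3) $x\hookrightarrow y\Rightarrow\mathrm{alloc}(x)$; (4) $(x\hookrightarrow y\wedge x\hookrightarrow z)\Rightarrow y=z$; (5) $\mathrm{size}\ge\beta+1\Rightarrow\mathrm{size}\ge\beta$ for $\beta\in\mathbb{N}$; (6) $\bigwedge_{x\in X}(\mathrm{alloc}(x)\wedge\bigwedge_{y\in X\setminus\{x\}}\neg(x=y))\Rightarrow\mathrm{size}\ge|X|$ for finite $X\subseteq\mathrm{PVAR}$. *)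

theory Defs
  imports "HOL-Library.Countable" "HOL-Library.Infinite_Typeclass"
begin

datatype 'v fm =
    Eq 'v 'v          (infix "\<^bold>=" 75)
  | Pto 'v 'v         (infix "\<hookrightarrow>" 75)
  | Emp
  | Neg "'v fm"       ("\<^bold>\<not> _" [70] 70)
  | And "'v fm" "'v fm"   (infixr "\<^bold>\<and>" 63)
  | Sep "'v fm" "'v fm"   (infixr "\<^bold>*" 65)
  | Wand "'v fm" "'v fm"  (infixr "\<^bold>-\<^bold>*" 64)

text \<open>In a memory state \<open>(s, h)\<close> the heap \<open>h\<close> is a partial map with finite domain. In the clause
  for separating conjunction the two subheaps are finite whenever \<open>h\<close> is.\<close>

primrec sat :: "('v \<Rightarrow> 'l) \<Rightarrow> ('l \<rightharpoonup> 'l) \<Rightarrow> 'v fm \<Rightarrow> bool" where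
  "sat s h (x \<^bold>= y) \<longleftrightarrow> s x = s y"
| "sat s h (x \<hookrightarrow> y) \<longleftrightarrow> h (s x) = Some (s y)"
| "sat s h Emp \<longleftrightarrow> dom h = {}"
| "sat s h (\<^bold>\<not> \<phi>) \<longleftrightarrow> \<not> sat s h \<phi>"
| "sat s h (\<phi> \<^bold>\<and> \<psi>) \<longleftrightarrow> sat s h \<phi> \<and> sat s h \<psi>"
| "sat s h (\<phi> \<^bold>* \<psi>) \<longleftrightarrow>
     (\<exists>h1 h2. dom h1 \<inter> dom h2 = {} \<and> h = h1 ++ h2 \<and> sat s h1 \<phi> \<and> sat s h2 \<psi>)"
| "sat s h (\<phi> \<^bold>-\<^bold>* \<psi>) \<longleftrightarrow>
     (\<forall>h1. finite (dom h1) \<and> dom h1 \<inter> dom h = {} \<and> sat s h1 \<phi> \<longrightarrow> sat s (h ++ h1) \<psi>)"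

definition valid :: "'l itself \<Rightarrow> 'v fm \<Rightarrow> bool" where
  "valid _ \<phi> \<longleftrightarrow> (\<forall>(s :: 'v \<Rightarrow> 'l) h. finite (dom h) \<longrightarrow> sat s h \<phi>)"

text \<open>The formula \<open>\<bottom> := \<not>(x = x)\<close> depends on the choice of \<open>x\<close>. In \<open>alloc(x) := (x \<hookrightarrow> x) -* \<bottom>\<close> the
  variable \<open>x\<close> itself is used, so that replacing variables in \<open>alloc(y)\<close> yields an \<open>alloc\<close>
  formula again. Where there is no such variable at hand, an arbitrary fixed one is taken.\<close>

abbreviation Bot :: "'v \<Rightarrow> 'v fm" where "Bot x \<equiv> \<^bold>\<not> (x \<^bold>= x)"
abbreviation Top :: "'v \<Rightarrow> 'v fm" where "Top x \<equiv> \<^bold>\<not> Bot x"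

definition v0 :: 'v where "v0 = (SOME x. True)"

abbreviation Imp :: "'v fm \<Rightarrow> 'v fm \<Rightarrow> 'v fm" (infixr "\<^bold>\<longrightarrow>" 61) where
  "\<phi> \<^bold>\<longrightarrow> \<psi> \<equiv> \<^bold>\<not> (\<phi> \<^bold>\<and> \<^bold>\<not> \<psi>)"

abbreviation Alloc :: "'v \<Rightarrow> 'v fm" where
  "Alloc x \<equiv> (x \<hookrightarrow> x) \<^bold>-\<^bold>* Bot x"

fun size_ge :: "nat \<Rightarrow> 'v fm" where
  "size_ge 0 = Top v0"
| "size_ge (Suc 0) = (\<^bold>\<not> Emp)"
| "size_ge (Suc (Suc n)) = (\<^bold>\<not> Emp) \<^bold>* size_ge (Suc n)"

inductive core :: "'v fm \<Rightarrow> bool" where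
  "core (x \<^bold>= y)"
| "core (Alloc x)"
| "core (x \<hookrightarrow> y)"
| "core (size_ge \<beta>)"

text \<open>Negation and conjunction are the only primitive Boolean connectives.\<close>

inductive core_combination :: "'v fm \<Rightarrow> bool" where
  "core \<phi> \<Longrightarrow> core_combination \<phi>"
| "core_combination \<phi> \<Longrightarrow> core_combination (\<^bold>\<not> \<phi>)"
| "core_combination \<phi> \<Longrightarrow> core_combination \<psi> \<Longrightarrow> core_combination (\<phi> \<^bold>\<and> \<psi>)"

definition Conj :: "'v fm list \<Rightarrow> 'v fm" where
  "Conj \<phi>s = foldr And \<phi>s (Top v0)"

text \<open>The rules \<open>K\<close>, \<open>S\<close>, \<open>contra\<close>, \<open>conj1\<close>, \<open>conj2\<close>, \<open>conjI\<close> are a standard complete set of axiom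
  schemata for classical propositional calculus with modus ponens. All metavariables range over
  arbitrary formulae. In \<open>ax2\<close> the replacement of \<open>y\<close> by \<open>x\<close> uses the map function of \<open>fm\<close>. In
  \<open>ax6\<close> the finite set \<open>X\<close> is enumerated by a list without repetitions, which fixes the order of
  the conjuncts; every enumeration is admitted.\<close>

inductive derivable :: "'v fm \<Rightarrow> bool" ("\<turnstile>\<^sub>C _" [60] 60) where
  K: "\<turnstile>\<^sub>C \<phi> \<^bold>\<longrightarrow> \<psi> \<^bold>\<longrightarrow> \<phi>"
| S: "\<turnstile>\<^sub>C (\<phi> \<^bold>\<longrightarrow> \<psi> \<^bold>\<longrightarrow> \<chi>) \<^bold>\<longrightarrow> (\<phi> \<^bold>\<longrightarrow> \<psi>) \<^bold>\<longrightarrow> \<phi> \<^bold>\<longrightarrow> \<chi>"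
| contra: "\<turnstile>\<^sub>C ((\<^bold>\<not> \<phi>) \<^bold>\<longrightarrow> (\<^bold>\<not> \<psi>)) \<^bold>\<longrightarrow> \<psi> \<^bold>\<longrightarrow> \<phi>"
| conj1: "\<turnstile>\<^sub>C (\<phi> \<^bold>\<and> \<psi>) \<^bold>\<longrightarrow> \<phi>"
| conj2: "\<turnstile>\<^sub>C (\<phi> \<^bold>\<and> \<psi>) \<^bold>\<longrightarrow> \<psi>"
| conjI: "\<turnstile>\<^sub>C \<phi> \<^bold>\<longrightarrow> \<psi> \<^bold>\<longrightarrow> (\<phi> \<^bold>\<and> \<psi>)"
| MP: "\<turnstile>\<^sub>C \<phi> \<Longrightarrow> \<turnstile>\<^sub>C \<phi> \<^bold>\<longrightarrow> \<psi> \<Longrightarrow> \<turnstile>\<^sub>C \<psi>"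
| ax1: "\<turnstile>\<^sub>C x \<^bold>= x"
| ax2: "\<turnstile>\<^sub>C (\<phi> \<^bold>\<and> (x \<^bold>= y)) \<^bold>\<longrightarrow> map_fm (id(y := x)) \<phi>"
| ax3: "\<turnstile>\<^sub>C (x \<hookrightarrow> y) \<^bold>\<longrightarrow> Alloc x"
| ax4: "\<turnstile>\<^sub>C ((x \<hookrightarrow> y) \<^bold>\<and> (x \<hookrightarrow> z)) \<^bold>\<longrightarrow> (y \<^bold>= z)"
| ax5: "\<turnstile>\<^sub>C size_ge (\<beta> + 1) \<^bold>\<longrightarrow> size_ge \<beta>"
| ax6: "distinct xs \<Longrightarrow> set xs = X \<Longrightarrow>
    \<turnstile>\<^sub>C Conj (map (\<lambda>x. Alloc x \<^bold>\<and> Conj (map (\<lambda>y. \<^bold>\<not> (x \<^bold>= y)) (removeAll x xs))) xs)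
        \<^bold>\<longrightarrow> size_ge (card X)"

end

theory Submission
  imports Defs
begin

text \<open>Completeness is Lindenbaum's argument. A deductively closed set that is maximal among those
  avoiding a given underivable \<open>\<phi>\<close> decides every formula, and a memory state is read off it: variables
  are sent to representatives of their provable-equality classes, allocated classes carry a cell,
  and cells at fresh locations are added until the heap has the size prescribed by the set. Axiom (6)
  guarantees that the prescribed size is at least the number of allocated classes. Since \<open>\<phi>\<close>
  mentions finitely many variables and sizes, a finite heap suffices.\<close>

section \<open>Soundness\<close>

text \<open>Serves the soundness of axiom (2): a store with \<open>s x = s y\<close> is unchanged by
  composition with \<open>id(y := x)\<close>. The heap is generalised because \<open>*\<close> and
  \<open>-*\<close> evaluate their arguments in other heaps.\<close>

lemma sat_map_fm: "sat s h (map_fm f \<phi>) \<longleftrightarrow> sat (s \<circ> f) h \<phi>"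
  by (induction \<phi> arbitrary: h) simp_all

text \<open>If \<open>s x\<close> is free, the one-cell loop at \<open>s x\<close> is a disjoint
  heap that refutes the wand. If \<open>s x\<close> is allocated, no disjoint heap satisfies the
  antecedent, so the wand holds vacuously.\<close>

lemma sat_Alloc: "sat s h (Alloc x) \<longleftrightarrow> s x \<in> dom h"
proof
  assume sat: "sat s h (Alloc x)"
  show "s x \<in> dom h"
  proof (rule ccontr)
    assume "s x \<notin> dom h"
    with sat[simplified, rule_format, of "[s x \<mapsto> s x]"] show False by simp
  qed
qed auto

lemma sat_size_ge: "finite (dom h) \<Longrightarrow> sat s h (size_ge n) \<longleftrightarrow> n \<le> card (dom h)"
proof (induction n arbitrary: h rule: size_ge.induct)
  case (3 n)
  show ?case
  proof
    assume "sat s h (size_ge (Suc (Suc n)))"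
    then obtain h1 h2 where h: "dom h1 \<inter> dom h2 = {}" "h = h1 ++ h2" "dom h1 \<noteq> {}"
      "sat s h2 (size_ge (Suc n))"
      by auto
    have fin: "finite (dom h1)" "finite (dom h2)" using 3 h by auto
    moreover have "card (dom h) = card (dom h1) + card (dom h2)"
      using h fin by (simp add: card_Un_disjoint Un_commute)
    moreover have "Suc n \<le> card (dom h2)" using 3 h fin by blast
    moreover have "card (dom h1) > 0" using fin h by (simp add: card_gt_0_iff)
    ultimately show "Suc (Suc n) \<le> card (dom h)" by linarith
  next
    assume le: "Suc (Suc n) \<le> card (dom h)"
    then obtain l where l: "l \<in> dom h" by fastforce
    \<comment> \<open>One cell is split off; the remaining heap has exactly one cell less, so the
      induction hypothesis applies to it.\<close>
    let ?h1 = "h |` {l}" and ?h2 = "h |` (- {l})"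
    have "dom ?h2 = dom h - {l}" by auto
    then have "sat s ?h2 (size_ge (Suc n))"
      using 3 le l by simp
    moreover have "dom ?h1 \<inter> dom ?h2 = {}" "h = ?h1 ++ ?h2" "dom ?h1 \<noteq> {}"
      using l by (auto simp: map_add_def restrict_map_def fun_eq_iff split: option.splits if_splits)
    ultimately show "sat s h (size_ge (Suc (Suc n)))" unfolding size_ge.simps sat.simps by blast
  qed
next
  case 2
  then show ?case by (auto simp: Suc_le_eq card_gt_0_iff)
qed simp

lemma sat_Conj: "sat s h (Conj \<phi>s) \<longleftrightarrow> (\<forall>\<phi>\<in>set \<phi>s. sat s h \<phi>)"
  by (induction \<phi>s) (simp_all add: Conj_def)

lemma soundness: "\<turnstile>\<^sub>C \<phi> \<Longrightarrow> finite (dom h) \<Longrightarrow> sat s h \<phi>"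
proof (induction rule: derivable.induct)
  case (ax2 \<phi> x y)
  have "s \<circ> id(y := x) = s" if "s x = s y" using that by auto
  then show ?case by (auto simp: sat_map_fm)
next
  case (ax3 x y)
  then show ?case using sat_Alloc[of s h x] by auto
next
  case (ax5 \<beta>)
  then show ?case by (simp add: sat_size_ge del: size_ge.simps)
next
  case (ax6 xs X)
  let ?\<psi> = "Conj (map (\<lambda>x. Alloc x \<^bold>\<and> Conj (map (\<lambda>y. \<^bold>\<not> (x \<^bold>= y)) (removeAll x xs))) xs)"
  have "card X \<le> card (dom h)" if "sat s h ?\<psi>"
  proof -
    \<comment> \<open>The conjunction makes \<open>s\<close> injective on \<open>X\<close> with
      image inside the domain, which bounds \<open>card X\<close>.\<close>
    have *: "sat s h (Alloc x) \<and> (\<forall>y\<in>X - {x}. s x \<noteq> s y)" if "x \<in> X" for x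
      using \<open>sat s h ?\<psi>\<close> that ax6 by (auto simp: sat_Conj)
    then have "s ` X \<subseteq> dom h" using sat_Alloc[of s h] by blast
    moreover have "inj_on s X" using * by (auto simp: inj_on_def)
    ultimately show ?thesis using ax6 by (metis card_image card_mono)
  qed
  then show ?case using ax6 by (simp only: sat.simps sat_size_ge) blast
qed auto


section \<open>Complete theories\<close>

text \<open>Consistency is not demanded: the set of all formulae is closed, and an extension by a
  refutable formula may be that set.\<close>

definition deductively_closed :: "'v fm set \<Rightarrow> bool" where
  "deductively_closed T \<longleftrightarrow>
     Collect derivable \<subseteq> T \<and> (\<forall>\<phi> \<psi>. \<phi> \<in> T \<longrightarrow> (\<phi> \<^bold>\<longrightarrow> \<psi>) \<in> T \<longrightarrow> \<psi> \<in> T)"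

lemma deductively_closed_derivable: "deductively_closed T \<Longrightarrow> \<turnstile>\<^sub>C \<phi> \<Longrightarrow> \<phi> \<in> T"
  by (auto simp: deductively_closed_def)

lemma deductively_closed_MP:
  "deductively_closed T \<Longrightarrow> (\<phi> \<^bold>\<longrightarrow> \<psi>) \<in> T \<Longrightarrow> \<phi> \<in> T \<Longrightarrow> \<psi> \<in> T"
  unfolding deductively_closed_def by blast

lemma deductively_closed_derivable_MP:
  "deductively_closed T \<Longrightarrow> \<turnstile>\<^sub>C \<phi> \<^bold>\<longrightarrow> \<psi> \<Longrightarrow> \<phi> \<in> T \<Longrightarrow> \<psi> \<in> T"
  by (blast intro: deductively_closed_derivable deductively_closed_MP)

text \<open>For closed \<open>T\<close> this is the least closed set containing \<open>T\<close> and
  \<open>\<chi>\<close>. The deduction theorem is built into the definition: an implication is put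
  into \<open>T\<close> by reasoning in the extension.\<close>

definition extend :: "'v fm set \<Rightarrow> 'v fm \<Rightarrow> 'v fm set" where
  "extend T \<chi> = {\<psi>. (\<chi> \<^bold>\<longrightarrow> \<psi>) \<in> T}"

lemma extend_superset: "deductively_closed T \<Longrightarrow> T \<subseteq> extend T \<chi>"
  unfolding extend_def using deductively_closed_derivable_MP[OF _ derivable.K] by blast

lemma deductively_closed_extend:
  assumes "deductively_closed T"
  shows "deductively_closed (extend T \<chi>)"
  unfolding deductively_closed_def
proof (intro HOL.conjI allI impI)
  show "Collect derivable \<subseteq> extend T \<chi>"
    using extend_superset[OF assms] deductively_closed_derivable[OF assms] by blast
  show "\<psi> \<in> extend T \<chi>" if "\<phi> \<in> extend T \<chi>" "(\<phi> \<^bold>\<longrightarrow> \<psi>) \<in> extend T \<chi>" for \<phi> \<psi>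
    using that deductively_closed_derivable_MP[OF assms derivable.S]
      deductively_closed_MP[OF assms]
    unfolding extend_def by blast
qed

text \<open>The usual derivation of \<open>\<chi> \<longrightarrow> \<chi>\<close> from one instance
  of \<open>S\<close> and two of \<open>K\<close>.\<close>

lemma extend_self: "deductively_closed T \<Longrightarrow> \<chi> \<in> extend T \<chi>"
  unfolding extend_def
  using deductively_closed_derivable_MP[OF _ derivable.S, of T \<chi> "\<chi> \<^bold>\<longrightarrow> \<chi>" \<chi>]
    deductively_closed_derivable[OF _ derivable.K] deductively_closed_MP
  by blast

lemma explosion:
  assumes "deductively_closed T" "\<chi> \<in> T" "(\<^bold>\<not> \<chi>) \<in> T"
  shows "\<phi> \<in> T"
proof -
  have "((\<^bold>\<not> \<phi>) \<^bold>\<longrightarrow> (\<^bold>\<not> \<chi>)) \<in> T"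
    using deductively_closed_derivable_MP[OF assms(1) derivable.K] assms by blast
  then show ?thesis
    using deductively_closed_derivable_MP[OF assms(1) derivable.contra] assms
      deductively_closed_MP by blast
qed

text \<open>Under the assumption of the double negation, \<open>K\<close> prefixes it with the
  fourfold negation, and two uses of \<open>contra\<close> strip the negations until
  \<open>\<chi>\<close> follows.\<close>

lemma double_negation:
  assumes T: "deductively_closed T"
  shows "((\<^bold>\<not> \<^bold>\<not> \<chi>) \<^bold>\<longrightarrow> \<chi>) \<in> T"
proof -
  let ?T = "extend T (\<^bold>\<not> \<^bold>\<not> \<chi>)"
  have T': "deductively_closed ?T" by (rule deductively_closed_extend[OF T])
  have "(\<^bold>\<not> \<^bold>\<not> \<chi>) \<in> ?T" by (rule extend_self[OF T])
  moreover from this have "((\<^bold>\<not> \<^bold>\<not> \<^bold>\<not> \<^bold>\<not> \<chi>) \<^bold>\<longrightarrow> (\<^bold>\<not> \<^bold>\<not> \<chi>)) \<in> ?T"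
    by (rule deductively_closed_derivable_MP[OF T' derivable.K])
  then have "((\<^bold>\<not> \<chi>) \<^bold>\<longrightarrow> (\<^bold>\<not> \<^bold>\<not> \<^bold>\<not> \<chi>)) \<in> ?T"
    by (rule deductively_closed_derivable_MP[OF T' derivable.contra])
  then have "((\<^bold>\<not> \<^bold>\<not> \<chi>) \<^bold>\<longrightarrow> \<chi>) \<in> ?T"
    by (rule deductively_closed_derivable_MP[OF T' derivable.contra])
  ultimately have "\<chi> \<in> ?T" using deductively_closed_MP[OF T'] by blast
  then show ?thesis by (simp add: extend_def)
qed

text \<open>Since \<open>contra\<close> only removes negations, the contradiction is first turned
  into the negation of a theorem \<open>?\<tau>\<close>. Weakening the premise \<open>\<chi>\<close>
  to its double negation then gives an implication of the shape that \<open>contra\<close>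
  accepts.\<close>

lemma negation_introduction:
  assumes T: "deductively_closed T" and "\<phi> \<in> extend T \<chi>" "(\<^bold>\<not> \<phi>) \<in> extend T \<chi>"
  shows "(\<^bold>\<not> \<chi>) \<in> T"
proof -
  let ?\<tau> = "v0 \<^bold>= v0" and ?T = "extend T (\<^bold>\<not> \<^bold>\<not> \<chi>)"
  have T': "deductively_closed ?T" by (rule deductively_closed_extend[OF T])
  have "(\<^bold>\<not> ?\<tau>) \<in> extend T \<chi>"
    using explosion[OF deductively_closed_extend] assms by blast
  then have "(\<chi> \<^bold>\<longrightarrow> (\<^bold>\<not> ?\<tau>)) \<in> ?T"
    using extend_superset[OF T] by (auto simp: extend_def)
  moreover have "\<chi> \<in> ?T" using double_negation[OF T] by (simp add: extend_def)
  ultimately have "((\<^bold>\<not> \<^bold>\<not> \<chi>) \<^bold>\<longrightarrow> (\<^bold>\<not> ?\<tau>)) \<in> T"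
    using deductively_closed_MP[OF T'] by (auto simp: extend_def)
  then have "(?\<tau> \<^bold>\<longrightarrow> (\<^bold>\<not> \<chi>)) \<in> T"
    by (rule deductively_closed_derivable_MP[OF T derivable.contra])
  then show ?thesis
    using deductively_closed_MP[OF T] deductively_closed_derivable[OF T derivable.ax1] by blast
qed

text \<open>Assuming the negation of \<open>\<phi>\<close>, the first premise refutes
  \<open>\<chi>\<close>, and then the second yields \<open>\<phi>\<close>, a contradiction.\<close>

lemma case_distinction:
  assumes T: "deductively_closed T" and "(\<chi> \<^bold>\<longrightarrow> \<phi>) \<in> T" "((\<^bold>\<not> \<chi>) \<^bold>\<longrightarrow> \<phi>) \<in> T"
  shows "\<phi> \<in> T"
proof -
  let ?T = "extend T (\<^bold>\<not> \<phi>)"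
  have T': "deductively_closed ?T" by (rule deductively_closed_extend[OF T])
  have neg: "(\<^bold>\<not> \<phi>) \<in> ?T" by (rule extend_self[OF T])
  have "\<phi> \<in> extend ?T \<chi>" using assms(2) extend_superset[OF T] by (auto simp: extend_def)
  moreover have "(\<^bold>\<not> \<phi>) \<in> extend ?T \<chi>" using neg extend_superset[OF T'] by blast
  ultimately have "(\<^bold>\<not> \<chi>) \<in> ?T" by (rule negation_introduction[OF T'])
  then have "\<phi> \<in> ?T" using assms(3) extend_superset[OF T] deductively_closed_MP[OF T'] by blast
  then have "(\<^bold>\<not> \<^bold>\<not> \<phi>) \<in> T" using neg by (rule negation_introduction[OF T])
  then show ?thesis using double_negation[OF T] deductively_closed_MP[OF T] by blast
qed

locale complete_theory =
  fixes T :: "'v fm set"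
  assumes closed: "deductively_closed T"
    and neg_iff: "(\<^bold>\<not> \<phi>) \<in> T \<longleftrightarrow> \<phi> \<notin> T"

lemma lindenbaum:
  assumes "\<not> \<turnstile>\<^sub>C \<phi>"
  obtains T where "complete_theory T" "\<phi> \<notin> T"
proof -
  let ?A = "{T. deductively_closed T \<and> \<phi> \<notin> T}"
  have "Collect derivable \<in> ?A"
    using assms by (auto simp: deductively_closed_def intro: derivable.MP)
  then have "?A \<noteq> {}" by blast
  moreover have "\<Union>C \<in> ?A" if "C \<noteq> {}" "subset.chain ?A C" for C
  proof -
    have C: "deductively_closed T" "\<phi> \<notin> T" if "T \<in> C" for T
      using that \<open>subset.chain ?A C\<close> by (auto simp: subset.chain_def)
    have "\<psi> \<in> \<Union>C" if "\<chi> \<in> \<Union>C" "(\<chi> \<^bold>\<longrightarrow> \<psi>) \<in> \<Union>C" for \<chi> \<psi>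
    proof -
      from that obtain T1 T2 where T12: "T1 \<in> C" "T2 \<in> C" "\<chi> \<in> T1" "(\<chi> \<^bold>\<longrightarrow> \<psi>) \<in> T2" by blast
      \<comment> \<open>Both premises of modus ponens lie in a single member of the chain, which is
        closed.\<close>
      moreover have "T1 \<subseteq> T2 \<or> T2 \<subseteq> T1"
        using \<open>subset.chain ?A C\<close> T12 by (auto simp: subset_chain_def)
      ultimately obtain T where "T \<in> C" "\<chi> \<in> T" "(\<chi> \<^bold>\<longrightarrow> \<psi>) \<in> T" by blast
      then show ?thesis using C deductively_closed_MP by blast
    qed
    moreover have "Collect derivable \<subseteq> \<Union>C"
      using \<open>C \<noteq> {}\<close> C deductively_closed_derivable by blast
    ultimately have "deductively_closed (\<Union>C)"
      unfolding deductively_closed_def by blast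
    then show ?thesis using C by blast
  qed
  ultimately obtain T where T: "T \<in> ?A" and max: "\<And>U. U \<in> ?A \<Longrightarrow> T \<subseteq> U \<Longrightarrow> U = T"
    using subset_Zorn_nonempty[of ?A] by blast
  have closed: "deductively_closed T" and "\<phi> \<notin> T" using T by auto
  \<comment> \<open>By maximality, a closed proper extension of \<open>T\<close> must contain
    \<open>\<phi>\<close>.\<close>
  have imp: "(\<chi> \<^bold>\<longrightarrow> \<phi>) \<in> T" if "\<chi> \<notin> T" for \<chi>
  proof (rule ccontr)
    assume "(\<chi> \<^bold>\<longrightarrow> \<phi>) \<notin> T"
    then have "extend T \<chi> \<in> ?A"
      using deductively_closed_extend[OF closed] by (simp add: extend_def)
    with max extend_superset[OF closed] have "extend T \<chi> = T" by blast
    with that extend_self[OF closed] show False by blast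
  qed
  \<comment> \<open>If both formulae were missing, each would imply \<open>\<phi>\<close> in
    \<open>T\<close>, and so \<open>\<phi>\<close> would belong to \<open>T\<close>. If both were
    present, \<open>\<phi>\<close> would follow by explosion.\<close>
  have "(\<^bold>\<not> \<chi>) \<in> T \<longleftrightarrow> \<chi> \<notin> T" for \<chi>
    using imp case_distinction[OF closed] explosion[OF closed] \<open>\<phi> \<notin> T\<close> by blast
  with closed have "complete_theory T" by unfold_locales auto
  with \<open>\<phi> \<notin> T\<close> that show thesis by blast
qed

section \<open>Equality, allocation and size inside a complete theory\<close>

context complete_theory
begin

lemma derivable_mem: "\<turnstile>\<^sub>C \<phi> \<Longrightarrow> \<phi> \<in> T"
  by (rule deductively_closed_derivable[OF closed])

lemma derivable_imp: "\<turnstile>\<^sub>C \<phi> \<^bold>\<longrightarrow> \<psi> \<Longrightarrow> \<phi> \<in> T \<Longrightarrow> \<psi> \<in> T"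
  by (rule deductively_closed_derivable_MP[OF closed])

lemma and_iff: "(\<phi> \<^bold>\<and> \<psi>) \<in> T \<longleftrightarrow> \<phi> \<in> T \<and> \<psi> \<in> T"
  using derivable_imp[OF derivable.conj1] derivable_imp[OF derivable.conj2]
    derivable_imp[OF derivable.conjI] deductively_closed_MP[OF closed]
  by blast

lemma Conj_iff: "Conj \<phi>s \<in> T \<longleftrightarrow> (\<forall>\<phi>\<in>set \<phi>s. \<phi> \<in> T)"
proof (induction \<phi>s)
  case Nil
  then show ?case using derivable_mem[OF derivable.ax1] by (simp add: Conj_def neg_iff)
next
  case (Cons \<phi> \<phi>s)
  then show ?case by (simp add: Conj_def and_iff)
qed

text \<open>Axiom (2) is one direction; applied to the negated formula it gives the converse,
  because \<open>T\<close> decides every formula.\<close>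

lemma replace_iff:
  assumes "(x \<^bold>= y) \<in> T"
  shows "map_fm (id(y := x)) \<phi> \<in> T \<longleftrightarrow> \<phi> \<in> T"
proof -
  have "map_fm (id(y := x)) \<psi> \<in> T" if "\<psi> \<in> T" for \<psi>
    using derivable_imp[OF derivable.ax2, of \<psi> x y] that assms by (simp add: and_iff)
  from this[of \<phi>] this[of "\<^bold>\<not> \<phi>"] show ?thesis by (auto simp: neg_iff)
qed

text \<open>The variable \<open>y\<close> no longer occurs in the conclusion of axiom (2), so the axiom alone does not even
  yield symmetry of equality; comparing two formulae that become equal under the replacement does.\<close>

lemma congruence:
  assumes "(x \<^bold>= y) \<in> T" "map_fm (id(y := x)) \<phi> = map_fm (id(y := x)) \<psi>"
  shows "\<phi> \<in> T \<longleftrightarrow> \<psi> \<in> T"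
  using replace_iff[OF assms(1)] assms(2) by metis

lemma eq_refl: "(x \<^bold>= x) \<in> T"
  by (rule derivable_mem[OF derivable.ax1])

lemma eq_sym: "(x \<^bold>= y) \<in> T \<Longrightarrow> (y \<^bold>= x) \<in> T"
  using congruence[of x y "y \<^bold>= x" "x \<^bold>= x"] eq_refl by simp

lemma eq_cong_left: "(x \<^bold>= y) \<in> T \<Longrightarrow> (x \<^bold>= z) \<in> T \<longleftrightarrow> (y \<^bold>= z) \<in> T"
  by (erule congruence) simp

lemma Alloc_cong: "(x \<^bold>= y) \<in> T \<Longrightarrow> Alloc x \<in> T \<longleftrightarrow> Alloc y \<in> T"
  by (erule congruence) simp

lemma Pto_cong:
  assumes "(x \<^bold>= x') \<in> T" "(y \<^bold>= y') \<in> T"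
  shows "(x \<hookrightarrow> y) \<in> T \<longleftrightarrow> (x' \<hookrightarrow> y') \<in> T"
proof -
  have "(x \<hookrightarrow> y) \<in> T \<longleftrightarrow> (x' \<hookrightarrow> y) \<in> T" by (rule congruence[OF assms(1)]) simp
  also have "\<dots> \<longleftrightarrow> (x' \<hookrightarrow> y') \<in> T" by (rule congruence[OF assms(2)]) simp
  finally show ?thesis .
qed

lemma Pto_functional:
  assumes "(x \<hookrightarrow> y) \<in> T" "(x' \<hookrightarrow> y') \<in> T" "(x \<^bold>= x') \<in> T"
  shows "(y \<^bold>= y') \<in> T"
  using assms Pto_cong[OF assms(3) eq_refl, of y'] derivable_imp[OF derivable.ax4, of x y y']
  by (simp add: and_iff)

lemma size_ge_antimono: "m \<le> n \<Longrightarrow> size_ge n \<in> T \<Longrightarrow> size_ge m \<in> T"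
proof (induction n rule: dec_induct)
  case (step n)
  then show ?case using derivable_imp[OF derivable.ax5, of n] by simp
qed

lemma size_ge_card_Alloc:
  assumes "finite X" "\<And>x. x \<in> X \<Longrightarrow> Alloc x \<in> T"
    and "\<And>x y. x \<in> X \<Longrightarrow> y \<in> X \<Longrightarrow> x \<noteq> y \<Longrightarrow> (x \<^bold>= y) \<notin> T"
  shows "size_ge (card X) \<in> T"
proof -
  obtain xs where xs: "distinct xs" "set xs = X"
    using finite_distinct_list[OF assms(1)] by blast
  show ?thesis
    by (rule derivable_imp[OF derivable.ax6[OF xs]])
      (use assms xs in \<open>auto simp: Conj_iff and_iff neg_iff\<close>)
qed

section \<open>The memory state of a complete theory\<close>

text \<open>Each variable goes to a chosen representative of its class, and the injection sends
  representatives to locations.\<close>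

lemma ex_store:
  assumes "\<exists>g :: 'v \<Rightarrow> 'l. inj g"
  obtains s :: "'v \<Rightarrow> 'l" where "\<And>x y. s x = s y \<longleftrightarrow> (x \<^bold>= y) \<in> T"
proof -
  from assms obtain g :: "'v \<Rightarrow> 'l" where g: "inj g" by blast
  define r where "r x = (SOME y. (x \<^bold>= y) \<in> T)" for x
  have r: "(x \<^bold>= r x) \<in> T" for x unfolding r_def by (rule someI, rule eq_refl)
  have "r x = r y \<longleftrightarrow> (x \<^bold>= y) \<in> T" for x y
  proof
    assume "r x = r y"
    then show "(x \<^bold>= y) \<in> T" using r[of x] r[of y] eq_cong_left[of x "r x" y] eq_sym by simp
  next
    assume "(x \<^bold>= y) \<in> T"
    \<comment> \<open>Equal classes give the same choice predicate, hence the same chosen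
      element.\<close>
    then show "r x = r y" by (simp add: r_def eq_cong_left[of x y])
  qed
  with g that[of "g \<circ> r"] show thesis by (simp add: inj_eq)
qed

text \<open>\<open>T\<close> may contain every \<open>size_ge n\<close>, so a finite heap can match
  it only up to a cut-off \<open>N\<close>. The bound \<open>card V \<le> N\<close> keeps the number
  of allocated classes within the range where sizes are compared.\<close>

lemma ex_heap:
  fixes s :: "'v \<Rightarrow> 'l"
  assumes "infinite (UNIV :: 'l set)" and V: "finite V" "card V \<le> N"
    and s: "\<And>x y. s x = s y \<longleftrightarrow> (x \<^bold>= y) \<in> T"
  obtains h where "finite (dom h)"
    and "\<And>x. x \<in> V \<Longrightarrow> s x \<in> dom h \<longleftrightarrow> Alloc x \<in> T"
    and "\<And>x y. x \<in> V \<Longrightarrow> y \<in> V \<Longrightarrow> h (s x) = Some (s y) \<longleftrightarrow> (x \<hookrightarrow> y) \<in> T"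
    and "\<And>n. n \<le> N \<Longrightarrow> n \<le> card (dom h) \<longleftrightarrow> size_ge n \<in> T"
proof -
  define A where "A = {x \<in> V. Alloc x \<in> T}"
  have "finite A" using V by (simp add: A_def)
  \<comment> \<open>The intended size of the heap: the largest size up to \<open>N\<close> that
    \<open>T\<close> asserts.\<close>
  define m where "m = Max {n. n \<le> N \<and> size_ge n \<in> T}"
  have fin: "finite {n. n \<le> N \<and> size_ge n \<in> T}" by simp
  have "size_ge 0 \<in> T" using eq_refl by (simp add: neg_iff)
  then have "{n. n \<le> N \<and> size_ge n \<in> T} \<noteq> {}" by blast
  from Max_in[OF fin this] have m: "size_ge m \<in> T" by (simp add: m_def)
  have size: "size_ge n \<in> T \<longleftrightarrow> n \<le> m" if "n \<le> N" for n
    using that size_ge_antimono[OF _ m] Max_ge[OF fin, of n, folded m_def] by blast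
  \<comment> \<open>\<open>X\<close> picks one variable from each allocated class, so its members
    are pairwise unequal in \<open>T\<close> and axiom (6) applies.\<close>
  obtain X where X: "X \<subseteq> A" "inj_on s X" "s ` A = s ` X"
    using subset_image_inj[of "s ` A" s A] by blast
  have "X \<subseteq> V" using X by (auto simp: A_def)
  then have "card X \<le> N" using V card_mono order_trans by blast
  moreover have "size_ge (card X) \<in> T"
  proof (rule size_ge_card_Alloc)
    show "finite X" using X \<open>finite A\<close> finite_subset by blast
    show "Alloc x \<in> T" if "x \<in> X" for x using that X by (auto simp: A_def)
    show "(x \<^bold>= y) \<notin> T" if "x \<in> X" "y \<in> X" "x \<noteq> y" for x y
      using that X s by (metis inj_onD)
  qed
  ultimately have k: "card (s ` A) \<le> m" using size X by (simp add: card_image)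
  have inf: "infinite (UNIV - s ` V)" using assms(1) V by (simp add: Diff_infinite_finite)
  then obtain P where P: "finite P" "card P = m - card (s ` A)" "P \<subseteq> UNIV - s ` V"
    using infinite_arbitrarily_large by blast
  \<comment> \<open>The default content \<open>l0\<close> is denoted by no variable of
    \<open>V\<close>, so cells filled with it satisfy no points-to formula over
    \<open>V\<close>.\<close>
  from inf obtain l0 where l0: "l0 \<notin> s ` V" by (metis DiffD2 finite.emptyI subsetI subset_empty)
  \<comment> \<open>The points-to facts of \<open>T\<close> read on locations: congruence makes them
    independent of the representative, and axiom (4) makes them functional.\<close>
  define target where "target l l' \<longleftrightarrow> (\<exists>x\<in>V. \<exists>y\<in>V. l = s x \<and> l' = s y \<and> (x \<hookrightarrow> y) \<in> T)" for l l'
  have target: "target (s x) (s y) \<longleftrightarrow> (x \<hookrightarrow> y) \<in> T" if "x \<in> V" "y \<in> V" for x y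
    using that Pto_cong eq_refl unfolding target_def s by blast
  have target_unique: "l' = l''" if "target l l'" "target l l''" for l l' l''
    using that Pto_functional s unfolding target_def by metis
  define h where "h l = (if l \<in> s ` A \<union> P
    then Some (if \<exists>l'. target l l' then SOME l'. target l l' else l0) else None)" for l
  have dom: "dom h = s ` A \<union> P" by (auto simp: h_def dom_def)
  have sA: "s x \<in> s ` A \<longleftrightarrow> Alloc x \<in> T" if "x \<in> V" for x
    using that by (auto simp: A_def s Alloc_cong)
  have alloc: "s x \<in> dom h \<longleftrightarrow> Alloc x \<in> T" if "x \<in> V" for x
    using that P(3) sA[OF that] by (auto simp: dom)
  have pto: "h (s x) = Some (s y) \<longleftrightarrow> (x \<hookrightarrow> y) \<in> T" if xy: "x \<in> V" "y \<in> V" for x y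
  proof
    assume "(x \<hookrightarrow> y) \<in> T"
    moreover from this have "s x \<in> s ` A"
      using sA[OF xy(1)] derivable_imp[OF derivable.ax3] by blast
    ultimately show "h (s x) = Some (s y)"
      using target[OF xy] target_unique by (auto simp: h_def intro: some_equality)
  next
    assume "h (s x) = Some (s y)"
    moreover have "s y \<noteq> l0" using l0 xy by blast
    ultimately have "target (s x) (s y)"
      unfolding h_def by (metis option.distinct(1) option.inject someI_ex)
    then show "(x \<hookrightarrow> y) \<in> T" using target[OF xy] by blast
  qed
  have "s ` A \<inter> P = {}" using P(3) by (auto simp: A_def)
  then have "card (dom h) = m"
    using k P \<open>finite A\<close> by (simp add: dom card_Un_disjoint)
  then show thesis using that[of h] dom P \<open>finite A\<close> alloc pto size by simp
qed

end

section \<open>Truth lemma and completeness\<close>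

text \<open>Lets the size of a formula serve as a bound for all thresholds in its size
  atoms.\<close>

lemma size_size_ge: "n \<le> size (size_ge n)"
  by (induction n rule: size_ge.induct) auto

text \<open>The induction follows the Boolean structure only. \<open>Alloc\<close> and
  \<open>size_ge\<close> count as atoms although they are built from \<open>-*\<close> and
  \<open>*\<close>; their semantic characterisations connect them with the hypotheses on the
  heap.\<close>

lemma (in complete_theory) truth_lemma:
  assumes "finite (dom h)"
    and s: "\<And>x y. s x = s y \<longleftrightarrow> (x \<^bold>= y) \<in> T"
    and alloc: "\<And>x. x \<in> V \<Longrightarrow> s x \<in> dom h \<longleftrightarrow> Alloc x \<in> T"
    and pto: "\<And>x y. x \<in> V \<Longrightarrow> y \<in> V \<Longrightarrow> h (s x) = Some (s y) \<longleftrightarrow> (x \<hookrightarrow> y) \<in> T"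
    and size: "\<And>n. n \<le> N \<Longrightarrow> n \<le> card (dom h) \<longleftrightarrow> size_ge n \<in> T"
  shows "core_combination \<phi> \<Longrightarrow> set_fm \<phi> \<subseteq> V \<Longrightarrow> size \<phi> \<le> N \<Longrightarrow> sat s h \<phi> \<longleftrightarrow> \<phi> \<in> T"
proof (induction rule: core_combination.induct)
  case (1 \<phi>)
  from 1(1) show ?case
  proof cases
    case (2 x)
    then show ?thesis using alloc[of x] 1 sat_Alloc[of s h x] by simp
  next
    case (4 \<beta>)
    then show ?thesis
      using size[of \<beta>] 1 size_size_ge[of \<beta>] sat_size_ge[OF assms(1)] by (metis order_trans)
  qed (use 1 s pto in auto)
qed (auto simp: neg_iff and_iff)

lemma finite_set_fm: "finite (set_fm \<phi>)"
  by (induction \<phi>) auto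

lemma completeness:
  fixes \<phi> :: "('v :: countable) fm"
  assumes "core_combination \<phi>" "valid TYPE('l :: infinite) \<phi>"
  shows "\<turnstile>\<^sub>C \<phi>"
proof (rule ccontr)
  assume "\<not> \<turnstile>\<^sub>C \<phi>"
  then obtain T where "complete_theory T" "\<phi> \<notin> T" by (rule lindenbaum)
  interpret complete_theory T by fact
  obtain f :: "nat \<Rightarrow> 'l" where "inj f"
    using infinite_countable_subset[OF infinite_UNIV] by blast
  then have "inj (f \<circ> (to_nat :: 'v \<Rightarrow> nat))" by (simp add: inj_compose)
  then obtain s :: "'v \<Rightarrow> 'l" where s: "\<And>x y. s x = s y \<longleftrightarrow> (x \<^bold>= y) \<in> T"
    using ex_store by blast
  \<comment> \<open>The first summand leaves room for all allocated classes, the second covers every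
    size atom of \<open>\<phi>\<close>.\<close>
  define N where "N = card (set_fm \<phi>) + size \<phi>"
  then have N: "card (set_fm \<phi>) \<le> N" "size \<phi> \<le> N" by simp_all
  obtain h where h: "finite (dom h)"
    "\<And>x. x \<in> set_fm \<phi> \<Longrightarrow> s x \<in> dom h \<longleftrightarrow> Alloc x \<in> T"
    "\<And>x y. x \<in> set_fm \<phi> \<Longrightarrow> y \<in> set_fm \<phi> \<Longrightarrow> h (s x) = Some (s y) \<longleftrightarrow> (x \<hookrightarrow> y) \<in> T"
    "\<And>n. n \<le> N \<Longrightarrow> n \<le> card (dom h) \<longleftrightarrow> size_ge n \<in> T"
    using ex_heap[OF infinite_UNIV finite_set_fm N(1) s] by blast
  have "sat s h \<phi> \<longleftrightarrow> \<phi> \<in> T"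
    by (rule truth_lemma[OF h(1) s h(2-4) assms(1) order_refl N(2)])
  with assms(2) h(1) \<open>\<phi> \<notin> T\<close> show False by (auto simp: valid_def)
qed

theorem theorem4p3:
  fixes \<phi> :: "('v :: {countable, infinite}) fm"
  assumes "core_combination \<phi>"
  shows "valid TYPE('l :: {countable, infinite}) \<phi> \<longleftrightarrow> \<turnstile>\<^sub>C \<phi>"
  using completeness[OF assms] soundness by (auto simp: valid_def)

end
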